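(* Let $a,b$ be nonzero real numbers and let $k$ be a positive even integer. Then for every real $x$ with $(ax)^2\ge-4b$, \[ \sqrt[k]{\tfrac{\psi^{a,b}_{k}(x)}{2}+\sqrt{\tfrac{(\psi^{a,b}_{k}(x))^2}{4}-b^k}}-\sqrt[k]{\tfrac{\psi^{a,b}_{k}(x)}{2}-\sqrt{\tfrac{(\psi^{a,b}_{k}(x))^2}{4}-b^k}}=\begin{cases}|ax|,& b>0,\\ \sqrt{a^2x^2+4b},& b<0,\end{cases} \] and \[ \sqrt[k]{\tfrac{\psi^{a,b}_{k}(x)}{2}+\sqrt{\tfrac{(\psi^{a,b}_{k}(x))^2}{4}-b^k}}+\sqrt[k]{\tfrac{\psi^{a,b}_{k}(x)}{2}-\sqrt{\tfrac{(\psi^{a,b}_{k}(x))^2}{4}-b^k}}=\begin{cases}\sqrt{a^2x^2+4b},& b>0,\\ |ax|,& b<0.\end{cases} \]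
   Context: The generalized Lucas polynomials are defined by $\psi^{a,b}_0(x)=2$, $\psi^{a,b}_1(x)=ax$, $\psi^{a,b}_j(x)=ax\,\psi^{a,b}_{j-1}(x)+b\,\psi^{a,b}_{j-2}(x)$ for $j\ge2$. $\sqrt{\cdot}$ denotes the nonnegative square root and, for even $k$, $\sqrt[k]{\cdot}$ the nonnegative $k$-th root of a nonnegative real. *)

theory Defs
  imports Complex_Main "HOL-Computational_Algebra.Polynomial"
begin

fun gen_lucas :: "real \<Rightarrow> real \<Rightarrow> nat \<Rightarrow> real poly" where
  "gen_lucas a b 0 = [:2:]"
| "gen_lucas a b (Suc 0) = [:0, a:]"
| "gen_lucas a b (Suc (Suc j)) = [:0, a:] * gen_lucas a b (Suc j) + smult b (gen_lucas a b j)"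

end

theory Submission imports Defs begin

text \<open>Let \<open>u, v = (a x \<plusminus> sqrt (a\<^sup>2 x\<^sup>2 + 4 b)) / 2\<close> be the roots of \<open>y\<^sup>2 = a x y + b\<close>. The Lucas
  polynomial takes the value \<open>u ^ k + v ^ k\<close>, and \<open>b ^ k = u ^ k * v ^ k\<close> for even \<open>k\<close>, so the two
  radicands are the larger and the smaller of \<open>u ^ k, v ^ k\<close>. The sum and the difference of
  their \<open>k\<close>-th roots are the larger and the smaller of \<open>\<bar>u + v\<bar>, \<bar>u - v\<bar>\<close>, and the sign of
  \<open>b = - u v\<close> tells which is which.\<close>

lemma poly_gen_lucas_eq_power_sum:
  fixes u v :: real
  assumes "u + v = a * x" and "u * v = - b"
  shows "poly (gen_lucas a b n) x = u ^ n + v ^ n"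
proof (induction n rule: induct_nat_012)
  case (ge2 j)
  have "poly (gen_lucas a b (Suc (Suc j))) x
      = (u + v) * (u ^ Suc j + v ^ Suc j) - u * v * (u ^ j + v ^ j)"
    using ge2 assms by (simp add: mult.commute)
  also have "\<dots> = u ^ Suc (Suc j) + v ^ Suc (Suc j)"
    by (simp add: algebra_simps)
  finally show ?case .
qed (use assms in \<open>auto simp: mult.commute\<close>)

lemma discriminant_eq_half_diff_squared:
  fixes p q :: "'a::field_char_0"
  shows "(p + q)\<^sup>2 / 4 - p * q = ((p - q) / 2)\<^sup>2"
  by (simp add: power2_eq_square field_simps)

lemma half_sum_plus_sqrt_discriminant_eq_max:
  fixes p q :: real
  shows "(p + q) / 2 + sqrt ((p + q)\<^sup>2 / 4 - p * q) = max p q"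
  unfolding discriminant_eq_half_diff_squared real_sqrt_abs by (simp add: max_def field_simps)

lemma half_sum_minus_sqrt_discriminant_eq_min:
  fixes p q :: real
  shows "(p + q) / 2 - sqrt ((p + q)\<^sup>2 / 4 - p * q) = min p q"
  unfolding discriminant_eq_half_diff_squared real_sqrt_abs by (simp add: min_def field_simps)

lemma mono_root: "k > 0 \<Longrightarrow> mono (root k)"
  by (simp add: mono_def)

lemma root_even_power_eq_abs:
  assumes "k > 0" and "even k"
  shows "root k (y ^ k) = \<bar>y\<bar>"
  using assms by (metis power_even_abs real_root_power_cancel abs_ge_zero)

lemma root_max_even_powers:
  assumes "k > 0" and "even k"
  shows "root k (max (u ^ k) (v ^ k)) = max \<bar>u\<bar> \<bar>v\<bar>"
  unfolding max_of_mono[OF mono_root[OF \<open>k > 0\<close>], symmetric] root_even_power_eq_abs[OF assms] ..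

lemma root_min_even_powers:
  assumes "k > 0" and "even k"
  shows "root k (min (u ^ k) (v ^ k)) = min \<bar>u\<bar> \<bar>v\<bar>"
  unfolding min_of_mono[OF mono_root[OF \<open>k > 0\<close>], symmetric] root_even_power_eq_abs[OF assms] ..

lemma max_abs_plus_min_abs:
  fixes u v :: "'a::linordered_idom"
  shows "max (abs u) (abs v) + min (abs u) (abs v) = max (abs (u + v)) (abs (u - v))"
  by linarith

lemma max_abs_minus_min_abs:
  fixes u v :: "'a::linordered_idom"
  shows "max (abs u) (abs v) - min (abs u) (abs v) = min (abs (u + v)) (abs (u - v))"
  by linarith

lemma nested_radicals_of_even_power_sum:
  fixes u v :: real
  assumes "k > 0" and "even k"
  defines "P \<equiv> (u ^ k + v ^ k) / 2 + sqrt ((u ^ k + v ^ k)\<^sup>2 / 4 - (u * v) ^ k)"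
    and "M \<equiv> (u ^ k + v ^ k) / 2 - sqrt ((u ^ k + v ^ k)\<^sup>2 / 4 - (u * v) ^ k)"
  shows "P \<ge> 0" and "M \<ge> 0"
    and "root k P - root k M = min \<bar>u + v\<bar> \<bar>u - v\<bar>"
    and "root k P + root k M = max \<bar>u + v\<bar> \<bar>u - v\<bar>"
proof -
  have P: "P = max (u ^ k) (v ^ k)"
    unfolding P_def power_mult_distrib by (rule half_sum_plus_sqrt_discriminant_eq_max)
  have M: "M = min (u ^ k) (v ^ k)"
    unfolding M_def power_mult_distrib by (rule half_sum_minus_sqrt_discriminant_eq_min)
  show "P \<ge> 0" "M \<ge> 0"
    using \<open>even k\<close> by (simp_all add: P M le_max_iff_disj zero_le_even_power)
  have roots: "root k P = max \<bar>u\<bar> \<bar>v\<bar>" "root k M = min \<bar>u\<bar> \<bar>v\<bar>"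
    unfolding P M using assms(1,2) by (rule root_max_even_powers root_min_even_powers)+
  show "root k P - root k M = min \<bar>u + v\<bar> \<bar>u - v\<bar>"
    unfolding roots by (rule max_abs_minus_min_abs)
  show "root k P + root k M = max \<bar>u + v\<bar> \<bar>u - v\<bar>"
    unfolding roots by (rule max_abs_plus_min_abs)
qed

lemma abs_diff_le_abs_sum_iff:
  fixes u v :: "'a::linordered_idom"
  shows "\<bar>u - v\<bar> \<le> \<bar>u + v\<bar> \<longleftrightarrow> 0 \<le> u * v"
proof -
  have "(u + v)\<^sup>2 - (u - v)\<^sup>2 = 4 * (u * v)"
    by (simp add: power2_eq_square algebra_simps)
  then show ?thesis
    unfolding abs_le_square_iff by linarith
qed

lemma obtain_reals_with_sum_and_product:
  fixes t c :: real
  assumes "4 * c \<le> t\<^sup>2"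
  obtains u v where "u + v = t" and "u * v = c" and "u - v = sqrt (t\<^sup>2 - 4 * c)"
proof
  define s where "s = sqrt (t\<^sup>2 - 4 * c)"
  then have "s\<^sup>2 = t\<^sup>2 - 4 * c"
    using assms by simp
  then show "(t + s) / 2 * ((t - s) / 2) = c"
    by (simp add: power2_eq_square field_simps)
  show "(t + s) / 2 + (t - s) / 2 = t" "(t + s) / 2 - (t - s) / 2 = sqrt (t\<^sup>2 - 4 * c)"
    by (simp_all add: s_def field_simps)
qed

theorem theorem6:
  fixes a b x :: real and k :: nat
  assumes "a \<noteq> 0" and "b \<noteq> 0"
    and "k > 0" and "even k"
    and "(a * x)\<^sup>2 \<ge> - 4 * b"
  shows "let \<psi> = poly (gen_lucas a b k) x;
             D = \<psi>\<^sup>2 / 4 - b ^ k;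
             P = \<psi> / 2 + sqrt D;
             M = \<psi> / 2 - sqrt D
         in D \<ge> 0 \<and> P \<ge> 0 \<and> M \<ge> 0 \<and>
            root k P - root k M = (if b > 0 then \<bar>a * x\<bar> else sqrt (a\<^sup>2 * x\<^sup>2 + 4 * b)) \<and>
            root k P + root k M = (if b > 0 then sqrt (a\<^sup>2 * x\<^sup>2 + 4 * b) else \<bar>a * x\<bar>)"
proof -
  obtain u v where sum: "u + v = a * x" and prod: "u * v = - b"
    and diff: "u - v = sqrt (a\<^sup>2 * x\<^sup>2 + 4 * b)"
    using obtain_reals_with_sum_and_product[of "- b" "a * x"] assms(5)
    by (auto simp: power_mult_distrib)
  have psi: "poly (gen_lucas a b k) x = u ^ k + v ^ k"
    by (rule poly_gen_lucas_eq_power_sum[OF sum prod])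
  have b_power: "b ^ k = (u * v) ^ k"
    using \<open>even k\<close> by (simp add: prod)
  have "(u ^ k + v ^ k)\<^sup>2 / 4 - (u * v) ^ k \<ge> 0"
    unfolding power_mult_distrib discriminant_eq_half_diff_squared by simp
  moreover have "\<bar>u - v\<bar> \<le> \<bar>u + v\<bar> \<longleftrightarrow> \<not> b > 0"
    by (simp add: abs_diff_le_abs_sum_iff prod not_less)
  moreover have "u - v \<ge> 0"
    using diff assms(5) by (simp add: power_mult_distrib)
  ultimately show ?thesis
    unfolding Let_def psi b_power sum[symmetric] diff[symmetric]
    using nested_radicals_of_even_power_sum[OF \<open>k > 0\<close> \<open>even k\<close>, of u v]
    by (auto simp: max_def min_def)
qed

end
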